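(* Let $g$ be the four-dimensional neutral signature Walker metric $$g = 2\,du\,(dv + A\,du + C\,dU) + 2\,dU\,(dV + B\,dU)$$ on a coordinate domain with coordinates $(u,v,U,V)$, where $$A = vA_1(u,U)+VA_2(u,U)+A_0(u,U),$$ $$B = VB_1(u,v,U)+B_0(u,v,U),$$ $$C = C_1(u,v,U)+VC_2(u,U)+C_0(u,U),$$ and all the functions $A_i, B_i, C_i$ are real analytic. Then: (i) $g$ is Kundt with a null, geodesic, expansion-free, shear-free and vorticity-free vector $X_a$ that is proportional to the covector $dU$ if and only if $A_{,V}=0$. (ii) $g$ is Kundt with a null, geodesic, expansion-free, shear-free and vorticity-free vector $X_a$ that is proportional to the covector $du$ if and only if $B_{,v}=B_{,vv}=0$.
   Context: Neutral signature means signature $(2,2)$. Products of differentials in the line element are symmetric products, so $g_{uv}=g_{UV}=1$, $g_{uu}=2A$, $g_{uU}=C$, $g_{UU}=2B$, and all other independent components vanish. A comma denotes a partial derivative with respect to a coordinate, a semicolon denotes the Levi-Civita covariant derivative of $g$, and indices are raised and lowered with $g$. A Walker metric is one admitting a totally null 2-dimensional invariant plane, i.e. null, mutually orthogonal $l,m$ with $\nabla_a(l\wedge m)=k_a\,(l\wedge m)$ for some covector $k_a$. For $g$ this plane corresponds to $du\wedge dU$. A metric is Kundt if it admits a nonzero (nowhere-vanishing) null vector field $X$ that is geodesic, expansion-free, shear-free and vorticity-free. This is understood as follows: for a null coframe $\{n_a, X_a, \tilde m_a, m_a\}$ with $X_a n^a=1$, $m_a\tilde m^a=-1$ and all other inner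 products zero, the spin coefficients $\kappa,\tilde\kappa,\rho,\tilde\rho,\sigma,\tilde\sigma$ associated with $X$ all vanish. These six spin coefficients are, up to sign, the components $X_{a;b}Y^aZ^b$ with $Y\in\{m,\tilde m\}$ and $Z\in\{X,m,\tilde m\}$. Equivalently, $X_{a;b}Y^aZ^b=0$ for all vector fields $Y,Z$ orthogonal to $X$. "Proportional to" a covector $\omega$ means $X_a=f\,\omega_a$ for some nowhere-vanishing function $f$. *)

theory Defs
  imports "HOL-Analysis.Analysis"
begin

section \<open>Real analytic and smooth functions on \<open>\<real>\<^sup>n\<close>\<close>

text \<open>A multi-index is a function \<open>'n \<Rightarrow> nat\<close>; the set of multi-indices is countable, and
  unordered summability over it is absolute convergence of the power series.\<close>

definition real_analytic_on :: "(real ^ 'n \<Rightarrow> real) \<Rightarrow> (real ^ 'n) set \<Rightarrow> bool" where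
  "real_analytic_on f S \<longleftrightarrow>
    (\<forall>p\<in>S. \<exists>r>0. \<exists>c :: ('n \<Rightarrow> nat) \<Rightarrow> real. \<forall>x\<in>ball p r.
       ((\<lambda>\<alpha>. c \<alpha> * (\<Prod>i\<in>UNIV. (x $ i - p $ i) ^ \<alpha> i)) has_sum f x) UNIV)"

definition coord_deriv :: "'n \<Rightarrow> (real ^ 'n \<Rightarrow> real) \<Rightarrow> real ^ 'n \<Rightarrow> real" where
  "coord_deriv i f p = deriv (\<lambda>t. f (p + t *\<^sub>R axis i 1)) 0"

text \<open>The following two notions are meant for open sets \<open>S\<close>.\<close>

primrec Ck_on :: "nat \<Rightarrow> (real ^ 'n \<Rightarrow> real) \<Rightarrow> (real ^ 'n) set \<Rightarrow> bool" where
  "Ck_on 0 f S \<longleftrightarrow> continuous_on S f"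
| "Ck_on (Suc k) f S \<longleftrightarrow> f differentiable_on S \<and> (\<forall>i. Ck_on k (coord_deriv i f) S)"

definition smooth_vector_field_on :: "(real ^ 'n \<Rightarrow> real ^ 'n) \<Rightarrow> (real ^ 'n) set \<Rightarrow> bool" where
  "smooth_vector_field_on X S \<longleftrightarrow> (\<forall>k i. Ck_on k (\<lambda>p. X p $ i) S)"


section \<open>Pseudo-Riemannian metrics in a coordinate chart\<close>

text \<open>A metric is given by its component matrices \<open>g p $ a $ b\<close>, vector and covector fields by
  their component vectors.\<close>

type_synonym 'n metric = "real ^ 'n \<Rightarrow> real ^ 'n ^ 'n"

definition metric_inner :: "'n metric \<Rightarrow> real ^ 'n \<Rightarrow> real ^ 'n \<Rightarrow> real ^ 'n \<Rightarrow> real" where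
  "metric_inner g p x y = (\<Sum>a\<in>UNIV. \<Sum>b\<in>UNIV. g p $ a $ b * x $ a * y $ b)"

definition lower :: "'n metric \<Rightarrow> (real ^ 'n \<Rightarrow> real ^ 'n) \<Rightarrow> real ^ 'n \<Rightarrow> real ^ 'n" where
  "lower g X p = (\<chi> a. \<Sum>b\<in>UNIV. g p $ a $ b * X p $ b)"

text \<open>\<open>christoffel g p c a b\<close> is \<open>\<Gamma>\<^sup>c\<^sub>a\<^sub>b\<close> at \<open>p\<close>.\<close>

definition christoffel :: "'n metric \<Rightarrow> real ^ 'n \<Rightarrow> 'n \<Rightarrow> 'n \<Rightarrow> 'n \<Rightarrow> real" where
  "christoffel g p c a b =
    (\<Sum>d\<in>UNIV. matrix_inv (g p) $ c $ d *
       (coord_deriv b (\<lambda>q. g q $ d $ a) p + coord_deriv a (\<lambda>q. g q $ d $ b) p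
         - coord_deriv d (\<lambda>q. g q $ a $ b) p)) / 2"

text \<open>\<open>cov_deriv g \<omega> p a b\<close> is \<open>\<omega>\<^sub>a\<^sub>;\<^sub>b\<close> at \<open>p\<close>: the last index is the direction of
  differentiation.\<close>

definition cov_deriv ::
    "'n metric \<Rightarrow> (real ^ 'n \<Rightarrow> real ^ 'n) \<Rightarrow> real ^ 'n \<Rightarrow> 'n \<Rightarrow> 'n \<Rightarrow> real" where
  "cov_deriv g \<omega> p a b =
    coord_deriv b (\<lambda>q. \<omega> q $ a) p - (\<Sum>c\<in>UNIV. christoffel g p c a b * \<omega> p $ c)"

definition proportional_on ::
    "(real ^ 'n) set \<Rightarrow> (real ^ 'n \<Rightarrow> real ^ 'n) \<Rightarrow> (real ^ 'n \<Rightarrow> real ^ 'n) \<Rightarrow> bool" where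
  "proportional_on S \<eta> \<omega> \<longleftrightarrow> (\<exists>f :: real ^ 'n \<Rightarrow> real. \<forall>p\<in>S. f p \<noteq> 0 \<and> \<eta> p = f p *\<^sub>R \<omega> p)"


section \<open>Kundt vector fields in neutral signature\<close>

text \<open>The null frame is written with contravariant vectors, \<open>(n\<^sup>a, X\<^sup>a, mt\<^sup>a, m\<^sup>a)\<close>; the
  corresponding null coframe is obtained by lowering indices. All four vectors are real, since the
  signature is neutral; \<open>mt\<close> is a second, independent vector paired with \<open>m\<close>.\<close>

definition null_frame ::
    "4 metric \<Rightarrow> real ^ 4 \<Rightarrow> real ^ 4 \<Rightarrow> real ^ 4 \<Rightarrow> real ^ 4 \<Rightarrow> real ^ 4 \<Rightarrow> bool" where
  "null_frame g p n X mt m \<longleftrightarrow>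
     metric_inner g p X n = 1 \<and> metric_inner g p m mt = - 1 \<and>
     metric_inner g p n n = 0 \<and> metric_inner g p X X = 0 \<and>
     metric_inner g p m m = 0 \<and> metric_inner g p mt mt = 0 \<and>
     metric_inner g p n m = 0 \<and> metric_inner g p n mt = 0 \<and>
     metric_inner g p X m = 0 \<and> metric_inner g p X mt = 0"

text \<open>The component \<open>X\<^sub>a\<^sub>;\<^sub>b Y\<^sup>a Z\<^sup>b\<close> at \<open>p\<close>.\<close>

definition cov_deriv_component ::
    "'n metric \<Rightarrow> (real ^ 'n \<Rightarrow> real ^ 'n) \<Rightarrow> real ^ 'n \<Rightarrow> real ^ 'n \<Rightarrow> real ^ 'n \<Rightarrow> real" where
  "cov_deriv_component g X p Y Z =
     (\<Sum>a\<in>UNIV. \<Sum>b\<in>UNIV. cov_deriv g (lower g X) p a b * Y $ a * Z $ b)"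

text \<open>Up to sign, the six components below are the spin coefficients associated with \<open>X\<close>:
  \<open>Z = X\<close> gives \<open>\<kappa>\<close> and its tilde partner (geodesic), \<open>Y = Z\<close> gives \<open>\<sigma>\<close> and its partner
  (shear), and \<open>{Y, Z} = {m, mt}\<close> gives \<open>\<rho>\<close> and its partner (expansion and vorticity). They are
  algebraic in the frame, so the frame may be chosen at each point separately, and their joint
  vanishing does not depend on the frame completing \<open>X\<close>.\<close>

definition spin_coefficients_vanish ::
    "4 metric \<Rightarrow> (real ^ 4 \<Rightarrow> real ^ 4) \<Rightarrow> real ^ 4 \<Rightarrow> real ^ 4 \<Rightarrow> real ^ 4 \<Rightarrow> bool" where
  "spin_coefficients_vanish g X p mt m \<longleftrightarrow>
     (\<forall>Y\<in>{m, mt}. \<forall>Z\<in>{X p, m, mt}. cov_deriv_component g X p Y Z = 0)"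

definition kundt_vector_field_on ::
    "4 metric \<Rightarrow> (real ^ 4) set \<Rightarrow> (real ^ 4 \<Rightarrow> real ^ 4) \<Rightarrow> bool" where
  "kundt_vector_field_on g S X \<longleftrightarrow>
     smooth_vector_field_on X S \<and>
     (\<forall>p\<in>S. X p \<noteq> 0 \<and> metric_inner g p (X p) (X p) = 0 \<and>
        (\<exists>n mt m. null_frame g p n (X p) mt m \<and> spin_coefficients_vanish g X p mt m))"


section \<open>The Walker metric\<close>

text \<open>The coordinates \<open>(u, v, U, V)\<close> are the components 1, 2, 3, 4 of a point of \<open>\<real>\<^sup>4\<close>.\<close>

abbreviation ix_u :: 4 where "ix_u \<equiv> 1"
abbreviation ix_v :: 4 where "ix_v \<equiv> 2"
abbreviation ix_U :: 4 where "ix_U \<equiv> 3"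
abbreviation ix_V :: 4 where "ix_V \<equiv> 4"

definition proj_uU :: "real ^ 4 \<Rightarrow> real ^ 2" where
  "proj_uU p = vector [p $ ix_u, p $ ix_U]"

definition proj_uvU :: "real ^ 4 \<Rightarrow> real ^ 3" where
  "proj_uvU p = vector [p $ ix_u, p $ ix_v, p $ ix_U]"

text \<open>\<open>2 du (dv + A du + C dU) + 2 dU (dV + B dU)\<close>, with symmetric products of differentials.\<close>

definition walker_metric ::
    "(real ^ 4 \<Rightarrow> real) \<Rightarrow> (real ^ 4 \<Rightarrow> real) \<Rightarrow> (real ^ 4 \<Rightarrow> real) \<Rightarrow> 4 metric" where
  "walker_metric A B C p = vector
     [vector [2 * A p, 1, C p,     0],
      vector [1,       0, 0,       0],
      vector [C p,     0, 2 * B p, 1],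
      vector [0,       0, 1,       0]]"

end

theory Submission
  imports Defs
begin

text \<open>
  The covectors proportional to \<open>dU\<close> are the lowered multiples \<open>f \<partial>\<^sub>V\<close> of the null vector
  \<open>\<partial>\<^sub>V\<close>, because \<open>g(\<partial>\<^sub>V, -) = dU\<close>. Let \<open>X = f \<partial>\<^sub>V\<close>. The row \<open>V\<close> of the metric is
  constant and \<open>g\<^sup>U\<^sup>d\<close> is nonzero only for \<open>d = V\<close>, so \<open>\<Gamma>\<^sup>U\<^sub>a\<^sub>b = - g\<^sub>a\<^sub>b\<^sub>,\<^sub>V / 2\<close> and
  \<open>X\<^sub>a\<^sub>;\<^sub>b = f\<^sub>,\<^sub>b \<delta>\<^sub>a\<^sub>U + f g\<^sub>a\<^sub>b\<^sub>,\<^sub>V / 2\<close>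
  (lemma \<open>cov_deriv_coordinate_multiple\<close>). Vectors \<open>Y, Z\<close> orthogonal to \<open>X\<close> have no
  component along \<open>\<partial>\<^sub>U\<close>. They annihilate the term with the derivatives of \<open>f\<close>, and of the
  remaining metric entries only \<open>g\<^sub>u\<^sub>u = 2 A\<close> varies, whence
  \<open>X\<^sub>a\<^sub>;\<^sub>b Y\<^sup>a Z\<^sup>b = f A\<^sub>,\<^sub>V Y\<^sup>u Z\<^sup>u\<close> (lemma \<open>cov_deriv_component_indices\<close>).

  If \<open>A\<^sub>,\<^sub>V = 0\<close>, all these components vanish, and \<open>\<partial>\<^sub>V\<close> is a Kundt vector once it is completed
  to a null frame (lemma \<open>null_frame_indices\<close>). Conversely, the two frame vectors \<open>m\<close> and
  \<open>mt\<close> lie in the span of \<open>\<partial>\<^sub>u, \<partial>\<^sub>v, \<partial>\<^sub>V\<close>, where the metric is \<open>2 du (dv + A du)\<close>;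
  their inner product is nonzero, so at least one of them has a nonzero component
  along \<open>\<partial>\<^sub>u\<close>, and the shear coefficient built from it is a nonzero multiple of \<open>A\<^sub>,\<^sub>V\<close>.

  Exchanging \<open>(u, v, A)\<close> with \<open>(U, V, B)\<close> preserves the form of the metric and turns the condition into
  \<open>B\<^sub>,\<^sub>v = 0\<close>. The argument is therefore carried out once, for indices \<open>i, l, j, k\<close> that stand for
  either arrangement of the coordinates.
\<close>


section \<open>Coordinate derivatives\<close>

lemma coord_deriv_cong:
  assumes "open S" "p \<in> S" "\<And>q. q \<in> S \<Longrightarrow> f q = h q"
  shows "coord_deriv i f p = coord_deriv i h p"
  unfolding coord_deriv_def
proof (rule deriv_cong_ev)
  have "((\<lambda>t::real. p + t *\<^sub>R axis i 1) \<longlongrightarrow> p + 0 *\<^sub>R axis i 1) (nhds 0)"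
    by (intro tendsto_intros filterlim_ident)
  then have "\<forall>\<^sub>F t in nhds (0::real). p + t *\<^sub>R axis i 1 \<in> S"
    using assms(1,2) by (auto dest: topological_tendstoD)
  then show "\<forall>\<^sub>F t in nhds 0. f (p + t *\<^sub>R axis i 1) = h (p + t *\<^sub>R axis i 1)"
    by eventually_elim (rule assms(3))
qed simp

lemma coord_deriv_const [simp]: "coord_deriv i (\<lambda>q. c) = (\<lambda>p. 0)"
  by (simp add: coord_deriv_def fun_eq_iff)

text \<open>If \<open>f\<close> is not differentiable, neither is \<open>c * f\<close>, and then
  \<^const>\<open>deriv\<close> gives both the same default value.\<close>

lemma deriv_cmult_eq_0_iff:
  fixes f :: "real \<Rightarrow> real"
  assumes "c \<noteq> 0"
  shows "deriv (\<lambda>t. c * f t) x = 0 \<longleftrightarrow> deriv f x = 0"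
proof (cases "f differentiable at x")
  case True
  then obtain d where d: "(f has_real_derivative d) (at x)"
    by (auto simp: real_differentiable_def)
  then have "((\<lambda>t. c * f t) has_real_derivative c * d) (at x)"
    by (rule DERIV_cmult)
  with d assms show ?thesis
    by (simp add: DERIV_imp_deriv)
next
  case False
  have "\<not> (\<lambda>t. c * f t) differentiable at x"
  proof
    assume "(\<lambda>t. c * f t) differentiable at x"
    then obtain d where "((\<lambda>t. c * f t) has_real_derivative d) (at x)"
      by (auto simp: real_differentiable_def)
    then have "((\<lambda>t. inverse c * (c * f t)) has_real_derivative inverse c * d) (at x)"
      by (rule DERIV_cmult)
    with False assms show False
      by (auto simp: real_differentiable_def mult.assoc[symmetric])
  qed
  with False have "(\<lambda>d. ((\<lambda>t. c * f t) has_field_derivative d) (at x)) =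
      (\<lambda>d. (f has_field_derivative d) (at x))"
    by (auto simp: real_differentiable_def)
  then show ?thesis
    by (simp add: deriv_def)
qed

lemma coord_deriv_cmult_eq_0_iff:
  "c \<noteq> 0 \<Longrightarrow> coord_deriv i (\<lambda>q. c * f q) p = 0 \<longleftrightarrow> coord_deriv i f p = 0"
  unfolding coord_deriv_def by (rule deriv_cmult_eq_0_iff)

lemma Ck_on_const: "Ck_on k (\<lambda>q. c) S"
  by (induction k arbitrary: c) auto

lemma smooth_vector_field_on_const: "smooth_vector_field_on (\<lambda>q. x) S"
  by (simp add: smooth_vector_field_on_def Ck_on_const)


section \<open>Covariant derivatives of multiples of a coordinate covector\<close>

lemma lower_eq_matrix_vector_mult: "lower g X p = g p *v X p"
  by (simp add: lower_def matrix_vector_mult_def)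

lemma axis_nth_if: "axis j (1::real) $ a = (if a = j then 1 else 0)"
  by (simp add: axis_def)

lemma matrix_inv_row:
  fixes M :: "real ^ 'n ^ 'n"
  assumes "invertible M" "M $ k = axis j 1"
  shows "matrix_inv M $ j = axis k 1"
proof -
  have "M ** matrix_inv M = mat 1"
    using assms(1) unfolding invertible_def matrix_inv_def by (rule someI_ex[THEN conjunct1])
  then have "(M ** matrix_inv M) $ k = mat 1 $ k"
    by simp
  then show ?thesis
    by (simp add: matrix_matrix_mult_def vec_eq_iff assms(2) axis_nth_if mat_def if_distrib
        if_distribR cong: if_cong)
qed

text \<open>Because lowering \<open>\<partial>\<^sub>k\<close> gives \<open>dx\<^sup>j\<close>, the index \<open>j\<close> of a Christoffel symbol is
  raised from \<open>k\<close>. The other two terms of the symbol differentiate the constant row \<open>k\<close> of the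
  metric.\<close>

lemma christoffel_dual_coordinate:
  fixes g :: "'n::finite metric"
  assumes "invertible (g p)" "\<And>q. g q $ k = axis j 1"
  shows "christoffel g p j a b = - coord_deriv k (\<lambda>q. g q $ a $ b) p / 2"
proof -
  have "christoffel g p j a b =
      (\<Sum>d\<in>UNIV. if d = k then - coord_deriv k (\<lambda>q. g q $ a $ b) p else 0) / 2"
    unfolding christoffel_def matrix_inv_row[of "g p" k j, OF assms(1) assms(2)]
    by (intro arg_cong[where f = "\<lambda>x. x / 2"] sum.cong) (auto simp: axis_nth_if assms(2))
  then show ?thesis
    by simp
qed

lemma cov_deriv_coordinate_multiple:
  fixes g :: "'n::finite metric"
  assumes "open S" "p \<in> S" "invertible (g p)" "\<And>q. g q $ k = axis j 1"
    and \<omega>: "\<forall>q\<in>S. \<omega> q = f q *\<^sub>R axis j 1"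
  shows "cov_deriv g \<omega> p a b =
    (if a = j then coord_deriv b f p else 0) + f p * coord_deriv k (\<lambda>q. g q $ a $ b) p / 2"
proof -
  have "coord_deriv b (\<lambda>q. \<omega> q $ a) p = coord_deriv b (\<lambda>q. if a = j then f q else 0) p"
    using assms(1,2) by (rule coord_deriv_cong) (simp add: \<omega> axis_nth_if)
  moreover have "(\<Sum>c\<in>UNIV. christoffel g p c a b * \<omega> p $ c) = christoffel g p j a b * f p"
    using assms(2) by (simp add: \<omega> axis_nth_if if_distrib cong: if_cong)
  ultimately show ?thesis
    by (simp add: cov_deriv_def
        christoffel_dual_coordinate[where g = g and k = k and j = j, OF assms(3,4)]
        split: if_splits)
qed

text \<open>Up to the factor \<open>f / 2\<close>, the spin coefficients of a vector with covector
  \<open>f dx\<^sup>j\<close> are components of the Lie derivative \<open>\<L>\<^bsub>\<partial>\<^sub>k\<^esub> g\<close>. The derivatives of \<open>f\<close>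
  enter only along \<open>dx\<^sup>j\<close>, which the vectors orthogonal to \<open>\<partial>\<^sub>k\<close> annihilate.\<close>

lemma cov_deriv_component_coordinate_multiple:
  fixes g :: "'n::finite metric"
  assumes "open S" "p \<in> S" "invertible (g p)" "\<And>q. g q $ k = axis j 1"
    and "\<forall>q\<in>S. lower g X q = f q *\<^sub>R axis j 1"
    and "Y $ j = 0"
  shows "cov_deriv_component g X p Y Z =
    f p / 2 * (\<Sum>a\<in>UNIV. \<Sum>b\<in>UNIV. coord_deriv k (\<lambda>q. g q $ a $ b) p * Y $ a * Z $ b)"
  unfolding cov_deriv_component_def sum_distrib_left
    cov_deriv_coordinate_multiple[where g = g and \<omega> = "lower g X" and f = f, OF assms(1-5)]
  using assms(6) by (intro sum.cong) auto


section \<open>Kundt vectors of a Walker metric\<close>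

text \<open>The Walker metric with its coordinates numbered freely: \<open>i, l, j, k\<close> may be
  \<open>u, v, U, V\<close> or \<open>U, V, u, v\<close>, which exchanges the coefficients \<open>A\<close> and \<open>B\<close>. A fact
  about \<open>dx\<^sup>j\<close> thus covers both null covectors.\<close>

locale walker_indices =
  fixes g :: "4 metric" and A B C :: "real ^ 4 \<Rightarrow> real" and i l j k :: 4
  assumes indices: "distinct [i, l, j, k]"
    and row_i: "\<And>q. g q $ i = (2 * A q) *\<^sub>R axis i 1 + axis l 1 + C q *\<^sub>R axis j 1"
    and row_l: "\<And>q. g q $ l = axis i 1"
    and row_j: "\<And>q. g q $ j = C q *\<^sub>R axis i 1 + (2 * B q) *\<^sub>R axis j 1 + axis k 1"
    and row_k: "\<And>q. g q $ k = axis j 1"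
begin

lemma UNIV_indices: "(UNIV :: 4 set) = {i, l, j, k}"
proof (rule sym, rule card_subset_eq)
  show "card {i, l, j, k} = card (UNIV :: 4 set)"
    using indices by simp
qed simp_all

lemma sum_indices: "(\<Sum>a\<in>UNIV. F a) = F i + F l + F j + F k" for F :: "4 \<Rightarrow> real"
  unfolding UNIV_indices using indices by (simp add: add.assoc)

lemma all_indices: "(\<forall>a. P a) \<longleftrightarrow> P i \<and> P l \<and> P j \<and> P k"
  using UNIV_indices by (metis UNIV_I insertE singletonD)

lemma entries:
  "g q $ i $ i = 2 * A q" "g q $ i $ l = 1" "g q $ i $ j = C q" "g q $ i $ k = 0"
  "g q $ l $ i = 1" "g q $ l $ l = 0" "g q $ l $ j = 0" "g q $ l $ k = 0"
  "g q $ j $ i = C q" "g q $ j $ l = 0" "g q $ j $ j = 2 * B q" "g q $ j $ k = 1"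
  "g q $ k $ i = 0" "g q $ k $ l = 0" "g q $ k $ j = 1" "g q $ k $ k = 0"
  using indices by (auto simp: row_i row_l row_j row_k axis_nth_if)

lemma axis_entries:
  "axis i (1::real) $ i = 1" "axis i (1::real) $ l = 0" "axis i (1::real) $ j = 0" "axis i (1::real) $ k = 0"
  "axis l (1::real) $ i = 0" "axis l (1::real) $ l = 1" "axis l (1::real) $ j = 0" "axis l (1::real) $ k = 0"
  "axis j (1::real) $ i = 0" "axis j (1::real) $ l = 0" "axis j (1::real) $ j = 1" "axis j (1::real) $ k = 0"
  "axis k (1::real) $ i = 0" "axis k (1::real) $ l = 0" "axis k (1::real) $ j = 0" "axis k (1::real) $ k = 1"
  using indices by (auto simp: axis_nth_if)

lemma metric_inner_indices:
  "metric_inner g p x y = 2 * A p * x $ i * y $ i + x $ i * y $ l + x $ l * y $ i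
     + C p * (x $ i * y $ j + x $ j * y $ i) + 2 * B p * x $ j * y $ j + x $ j * y $ k + x $ k * y $ j"
  by (simp add: metric_inner_def sum_indices entries algebra_simps)

lemma lower_eq_iff: "lower g X p = c *\<^sub>R axis j 1 \<longleftrightarrow> X p = c *\<^sub>R axis k 1"
  by (auto simp: lower_def vec_eq_iff all_indices sum_indices entries axis_entries)

lemma invertible_metric: "invertible (g p)"
proof -
  have "x = 0" if "g p *v x = 0" for x
    using lower_eq_iff[of "\<lambda>_. x" p 0] that by (simp add: lower_eq_matrix_vector_mult)
  then show ?thesis
    by (simp add: invertible_left_inverse matrix_left_invertible_ker)
qed

text \<open>Orthogonality to \<open>X\<close> removes the components along \<open>\<partial>\<^sub>j\<close>, and the only entry of the metric
  left that need not be constant is the coefficient of \<open>(dx\<^sup>i)\<^sup>2\<close>.\<close>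

lemma cov_deriv_component_indices:
  assumes "open D" "p \<in> D" "\<forall>q\<in>D. lower g X q = f q *\<^sub>R axis j 1"
    and "Y $ j = 0" "Z $ j = 0"
  shows "cov_deriv_component g X p Y Z = f p / 2 * coord_deriv k (\<lambda>q. 2 * A q) p * Y $ i * Z $ i"
  unfolding cov_deriv_component_coordinate_multiple
    [where k = k and f = f, OF assms(1,2) invertible_metric row_k assms(3,4)]
  by (simp add: sum_indices entries assms(4,5))

text \<open>Since \<open>m\<close> and \<open>mt\<close> have inner product \<open>-1\<close> and no component along \<open>\<partial>\<^sub>j\<close>, one of them has
  a nonzero component along \<open>\<partial>\<^sub>i\<close>; its shear coefficient forces the derivative to vanish.\<close>

lemma kundt_imp_deriv_eq_0:
  assumes "open D" "p \<in> D" and X: "kundt_vector_field_on g D X"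
    and "proportional_on D (lower g X) (\<lambda>p. axis j 1)"
  shows "coord_deriv k A p = 0"
proof -
  obtain f where f: "\<forall>q\<in>D. f q \<noteq> 0" "\<forall>q\<in>D. lower g X q = f q *\<^sub>R axis j 1"
    using assms(4) by (auto simp: proportional_on_def)
  have Xp: "X p = f p *\<^sub>R axis k 1"
    using f(2) assms(2) by (simp add: lower_eq_iff)
  obtain n mt m where frame: "null_frame g p n (X p) mt m"
    and spin: "spin_coefficients_vanish g X p mt m"
    using X assms(2) by (auto simp: kundt_vector_field_on_def)
  have j0: "m $ j = 0" "mt $ j = 0"
    using frame f(1) assms(2)
    by (auto simp: null_frame_def metric_inner_indices Xp axis_entries)
  have "metric_inner g p m mt = - 1"
    using frame by (simp add: null_frame_def)
  then have "m $ i \<noteq> 0 \<or> mt $ i \<noteq> 0"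
    by (auto simp: metric_inner_indices j0)
  then obtain Y where Y: "Y \<in> {m, mt}" "Y $ i \<noteq> 0" "Y $ j = 0"
    using j0 by blast
  have "cov_deriv_component g X p Y Y = 0"
    using spin Y(1) by (auto simp: spin_coefficients_vanish_def)
  then have "coord_deriv k (\<lambda>q. 2 * A q) p = 0"
    using Y f(1) assms(2)
    by (simp add: cov_deriv_component_indices[OF assms(1,2) f(2)])
  then show ?thesis
    by (simp add: coord_deriv_cmult_eq_0_iff)
qed

text \<open>With \<open>m = \<partial>\<^sub>l\<close>, the other frame vectors come from \<open>- \<partial>\<^sub>i\<close> and \<open>\<partial>\<^sub>j\<close> by adding
  multiples of \<open>\<partial>\<^sub>l\<close> and \<open>\<partial>\<^sub>k\<close> that remove the entries \<open>2 A\<close>, \<open>C\<close> and \<open>2 B\<close>.\<close>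

lemma null_frame_indices:
  "null_frame g p (axis j 1 - C p *\<^sub>R axis l 1 - B p *\<^sub>R axis k 1) (axis k 1)
     (A p *\<^sub>R axis l 1 - axis i 1) (axis l 1)"
  by (simp add: null_frame_def metric_inner_indices axis_entries)

lemma deriv_eq_0_imp_kundt:
  assumes "open D" "\<And>p. p \<in> D \<Longrightarrow> coord_deriv k A p = 0"
  shows "kundt_vector_field_on g D (\<lambda>p. axis k 1)"
  unfolding kundt_vector_field_on_def
proof (intro conjI ballI smooth_vector_field_on_const)
  fix p assume p: "p \<in> D"
  show "axis k 1 \<noteq> (0 :: real ^ 4)"
    by (simp add: axis_eq_0_iff)
  show "metric_inner g p (axis k 1) (axis k 1) = 0"
    using null_frame_indices[of p] by (simp add: null_frame_def)
  have "coord_deriv k (\<lambda>q. 2 * A q) p = 0"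
    using assms(2)[OF p] by (simp add: coord_deriv_cmult_eq_0_iff)
  moreover have "lower g (\<lambda>p. axis k 1) q = 1 *\<^sub>R axis j 1" for q
    by (simp only: lower_eq_iff) simp
  ultimately have "cov_deriv_component g (\<lambda>p. axis k 1) p Y Z = 0"
    if "Y $ j = 0" "Z $ j = 0" for Y Z
    using cov_deriv_component_indices[OF assms(1) p, of _ "\<lambda>_. 1"] that by simp
  then have "spin_coefficients_vanish g (\<lambda>p. axis k 1) p (A p *\<^sub>R axis l 1 - axis i 1) (axis l 1)"
    by (auto simp: spin_coefficients_vanish_def axis_entries)
  with null_frame_indices
  show "\<exists>n mt m. null_frame g p n (axis k 1) mt m \<and>
      spin_coefficients_vanish g (\<lambda>p. axis k 1) p mt m"
    by blast
qed

lemma kundt_iff: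
  assumes "open D"
  shows "(\<exists>X. kundt_vector_field_on g D X \<and> proportional_on D (lower g X) (\<lambda>p. axis j 1)) \<longleftrightarrow>
    (\<forall>p\<in>D. coord_deriv k A p = 0)"
proof
  assume "\<forall>p\<in>D. coord_deriv k A p = 0"
  then have "kundt_vector_field_on g D (\<lambda>p. axis k 1)"
    using assms by (simp add: deriv_eq_0_imp_kundt)
  moreover have "lower g (\<lambda>p. axis k 1) q = 1 *\<^sub>R axis j 1" for q
    by (simp only: lower_eq_iff) simp
  then have "proportional_on D (lower g (\<lambda>p. axis k 1)) (\<lambda>p. axis j 1)"
    unfolding proportional_on_def by (intro exI[of _ "\<lambda>_. 1"]) simp
  ultimately show "\<exists>X. kundt_vector_field_on g D X \<and> proportional_on D (lower g X) (\<lambda>p. axis j 1)"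
    by blast
qed (use assms kundt_imp_deriv_eq_0 in blast)

end

lemma vector_4:
  fixes x y z w :: "'a::zero"
  shows "(vector [x, y, z, w] :: 'a ^ 4) $ 1 = x" "(vector [x, y, z, w] :: 'a ^ 4) $ 2 = y"
    "(vector [x, y, z, w] :: 'a ^ 4) $ 3 = z" "(vector [x, y, z, w] :: 'a ^ 4) $ 4 = w"
  unfolding vector_def by simp_all

lemma walker_metric_indices_uvUV:
  "walker_indices (walker_metric A B C) A B C ix_u ix_v ix_U ix_V"
  by unfold_locales (simp_all add: walker_metric_def vec_eq_iff forall_4 axis_nth_if vector_4)

lemma walker_metric_indices_UVuv:
  "walker_indices (walker_metric A B C) B A C ix_U ix_V ix_u ix_v"
  by unfold_locales (simp_all add: walker_metric_def vec_eq_iff forall_4 axis_nth_if vector_4)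

theorem proposition2p1:
  fixes D :: "(real ^ 4) set"
    and A B C :: "real ^ 4 \<Rightarrow> real"
    and A0 A1 A2 C0 C2 :: "real ^ 2 \<Rightarrow> real"
    and B0 B1 C1 :: "real ^ 3 \<Rightarrow> real"
    and g :: "4 metric"
  assumes "open D"
    and "\<And>p. p \<in> D \<Longrightarrow>
          A p = p $ ix_v * A1 (proj_uU p) + p $ ix_V * A2 (proj_uU p) + A0 (proj_uU p)"
    and "\<And>p. p \<in> D \<Longrightarrow>
          B p = p $ ix_V * B1 (proj_uvU p) + B0 (proj_uvU p)"
    and "\<And>p. p \<in> D \<Longrightarrow>
          C p = C1 (proj_uvU p) + p $ ix_V * C2 (proj_uU p) + C0 (proj_uU p)"
    and "real_analytic_on A0 (proj_uU ` D)"
    and "real_analytic_on A1 (proj_uU ` D)"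
    and "real_analytic_on A2 (proj_uU ` D)"
    and "real_analytic_on B0 (proj_uvU ` D)"
    and "real_analytic_on B1 (proj_uvU ` D)"
    and "real_analytic_on C0 (proj_uU ` D)"
    and "real_analytic_on C1 (proj_uvU ` D)"
    and "real_analytic_on C2 (proj_uU ` D)"
    and "g = walker_metric A B C"
  shows "((\<exists>X. kundt_vector_field_on g D X \<and>
              proportional_on D (lower g X) (\<lambda>p. axis ix_U 1)) \<longleftrightarrow>
           (\<forall>p\<in>D. coord_deriv ix_V A p = 0)) \<and>
         ((\<exists>X. kundt_vector_field_on g D X \<and>
              proportional_on D (lower g X) (\<lambda>p. axis ix_u 1)) \<longleftrightarrow>
           (\<forall>p\<in>D. coord_deriv ix_v B p = 0 \<and> coord_deriv ix_v (coord_deriv ix_v B) p = 0))"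
proof (intro conjI)
  note g = \<open>g = walker_metric A B C\<close>
  show "(\<exists>X. kundt_vector_field_on g D X \<and> proportional_on D (lower g X) (\<lambda>p. axis ix_U 1)) \<longleftrightarrow>
      (\<forall>p\<in>D. coord_deriv ix_V A p = 0)"
    unfolding g using \<open>open D\<close> by (rule walker_indices.kundt_iff[OF walker_metric_indices_uvUV])
  have "(\<exists>X. kundt_vector_field_on g D X \<and> proportional_on D (lower g X) (\<lambda>p. axis ix_u 1)) \<longleftrightarrow>
      (\<forall>p\<in>D. coord_deriv ix_v B p = 0)"
    unfolding g using \<open>open D\<close> by (rule walker_indices.kundt_iff[OF walker_metric_indices_UVuv])
  \<comment> \<open>\<open>D\<close> is open, so if \<open>B\<^sub>,\<^sub>v\<close> vanishes on \<open>D\<close>, its derivative vanishes there too.\<close>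
  moreover have "coord_deriv ix_v (coord_deriv ix_v B) p = 0"
    if "p \<in> D" "\<forall>q\<in>D. coord_deriv ix_v B q = 0" for p
    using coord_deriv_cong[OF \<open>open D\<close> that(1), of "coord_deriv ix_v B" "\<lambda>_. 0" ix_v] that(2)
    by simp
  ultimately show "(\<exists>X. kundt_vector_field_on g D X \<and> proportional_on D (lower g X) (\<lambda>p. axis ix_u 1)) \<longleftrightarrow>
      (\<forall>p\<in>D. coord_deriv ix_v B p = 0 \<and> coord_deriv ix_v (coord_deriv ix_v B) p = 0)"
    by blast
qed

end
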